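(* Let $X$ be a Hilbert space, let $\Omega_1,\dots,\Omega_n$ be nonempty closed subsets of $X$, and let $\bar x\in X$ be a local optimal solution (local minimizer) of the problem $$\text{minimize } D(x):=\sum_{i=1}^n d(x;\Omega_i),\quad x\in X,$$ such that for each $i=1,\dots,n$ the distance function $d(\cdot;\Omega_i)$ is well posed at $\bar x$ when $\bar x\notin\Omega_i$. Then $$0\in\sum_{i=1}^n A_i(\bar x),$$ where, for $i=1,\dots,n$, $$A_i(\bar x)=\begin{cases}\dfrac{\bar x-\Pi(\bar x;\Omega_i)}{d(\bar x;\Omega_i)} & \text{if }\bar x\notin\Omega_i,\\[2ex] N(\bar x;\Omega_i)\cap \mathbb B & \text{if }\bar x\in\Omega_i.\end{cases}$$
   Context: $X$ is identified with its dual, and $\mathbb B$ is the closed unit ball of $X$. $d(x;\Omega):=\inf\{\|x-\omega\|\mid\omega\in\Omega\}$ is the distance function and $\Pi(x;\Omega):=\{\omega\in\Omega\mid\|x-\omega\|=d(x;\Omega)\}$ is the (set-valued) metric projection; $\frac{\bar x-\Pi(\bar x;\Omega_i)}{d(\bar x;\Omega_i)}$ denotes the set $\{(\bar x-\omega)/d(\bar x;\Omega_i)\mid\omega\in\Pi(\bar x;\Omega_i)\}$. Sums of sets are Minkowski sums. Well-posedness: $d(\cdot;\Omega)$ is well posed at $\bar x\notin\Omega$ if for any sequence $x_k\to\bar x$ (so that $d(x_k;\Omega)\to d(\bar x;\Omega)$) there is a sequence $w_k\in\Pi(x_k;\Omega)$ containing a convergent subsequence. Basic (limiting, Mordukhovich)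 normal cone: for $\varepsilon\ge0$ and $x\in\Omega$ let $$\widehat N_\varepsilon(x;\Omega):=\Big\{x^*\in X\ \Big|\ \limsup_{u\to x,\,u\in\Omega}\frac{\langle x^*,u-x\rangle}{\|u-x\|}\le\varepsilon\Big\},$$ and $\widehat N_\varepsilon(x;\Omega):=\emptyset$ if $x\notin\Omega$. Then $N(\bar x;\Omega)$ is the set of all $x^*$ for which there are sequences $\varepsilon_k\downarrow0$, $x_k\to\bar x$ and $x_k^*\in\widehat N_{\varepsilon_k}(x_k;\Omega)$ with $x^*_k\to x^*$ weakly. *)

theory Defs
  imports "HOL-Analysis.Analysis" "HOL-Library.Set_Algebras"
begin

definition metric_proj :: "'a::real_normed_vector \<Rightarrow> 'a set \<Rightarrow> 'a set" where
  "metric_proj x S = {w \<in> S. norm (x - w) = infdist x S}"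

definition dist_well_posed_at :: "'a::real_normed_vector \<Rightarrow> 'a set \<Rightarrow> bool" where
  "dist_well_posed_at x S \<longleftrightarrow>
    (\<forall>u. u \<longlonglongrightarrow> x \<longrightarrow>
      (\<exists>w. (\<forall>k. w k \<in> metric_proj (u k) S) \<and>
           (\<exists>r::nat \<Rightarrow> nat. strict_mono r \<and> convergent (w \<circ> r))))"

definition weakly_tendsto :: "(nat \<Rightarrow> 'a::real_inner) \<Rightarrow> 'a \<Rightarrow> bool" where
  "weakly_tendsto xs x \<longleftrightarrow> (\<forall>y. (\<lambda>k. xs k \<bullet> y) \<longlonglongrightarrow> x \<bullet> y)"

(* At an isolated point x of S the filter is trivial, the upper limit is -\<infinity>,
   and every vector is an eps-normal. *)
definition eps_normals :: "real \<Rightarrow> 'a::real_inner \<Rightarrow> 'a set \<Rightarrow> 'a set" where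
  "eps_normals eps x S =
    (if x \<in> S
     then {v. Limsup (at x within S) (\<lambda>u. ereal ((v \<bullet> (u - x)) / norm (u - x))) \<le> ereal eps}
     else {})"

definition limiting_normal_cone :: "'a::real_inner \<Rightarrow> 'a set \<Rightarrow> 'a set" where
  "limiting_normal_cone x S =
    {v. \<exists>(eps :: nat \<Rightarrow> real) xs vs.
          (\<forall>k. 0 \<le> eps k) \<and> decseq eps \<and> eps \<longlonglongrightarrow> 0 \<and> xs \<longlonglongrightarrow> x \<and>
          (\<forall>k. vs k \<in> eps_normals (eps k) (xs k) S) \<and> weakly_tendsto vs v}"

definition local_minimizer :: "('a::topological_space \<Rightarrow> real) \<Rightarrow> 'a \<Rightarrow> bool" where
  "local_minimizer f x \<longleftrightarrow> (\<forall>\<^sub>F y in nhds x. f x \<le> f y)"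

definition fermat_set :: "'a::real_inner \<Rightarrow> 'a set \<Rightarrow> 'a set" where
  "fermat_set x S =
    (if x \<notin> S
     then (\<lambda>w. (x - w) /\<^sub>R infdist x S) ` metric_proj x S
     else limiting_normal_cone x S \<inter> cball 0 1)"

end

theory Submission
  imports Defs "HOL-Complex_Analysis.Great_Picard"
begin

text \<open>
  Fermat's rule for a sum of distance functions: near the minimizer, split the problem into
  independent variables, write down a stationarity condition with a small error, and let the error
  tend to zero.

  Call \<open>\<Omega> i\<close> active when it contains \<open>xbar\<close>. For an active set the distance is itself an infimum,
  \<open>d(x; \<Omega> i) = inf {norm (x - w) | w \<in> \<Omega> i}\<close>, so \<open>w\<close> can be made a variable of its own. Minimizing
  \<open>(\<Sum>i active. norm (x - w i)) + (\<Sum>i inactive. d(x; \<Omega> i))\<close> over \<open>x\<close> and \<open>w i \<in> \<Omega> i\<close> is then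
  locally the original problem, solved by \<open>x = w i = xbar\<close>. Two obstacles remain: the norm has a kink
  exactly at this solution, and once it is smoothed the infimum need not be attained. The first
  is removed by replacing \<open>norm z\<close> with \<open>sqrt ((norm z)\<^sup>2 + \<delta>\<^sup>2)\<close>, which changes the objective by at
  most \<open>\<delta>\<close> per summand; the second by Ekeland's variational principle, which supplies
  a nearby point that minimizes the objective up to an \<open>\<epsilon>\<close>-Lipschitz error.

  At that point (lemma \<open>fuzzy_fermat\<close>), varying one \<open>w i\<close> inside \<open>\<Omega> i\<close> shows that the
  gradient of the smoothed norm at \<open>x - w i\<close>, a vector in the unit ball, is an \<open>\<epsilon>\<close>-normal of \<open>\<Omega> i\<close>
  at \<open>w i\<close>. When \<open>x\<close> is varied, each inactive distance is dominated by \<open>norm (y - p i)\<close> with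
  \<open>p i\<close> a projection of \<open>x\<close>; this majorant touches it at \<open>x\<close> and is smooth there, because
  \<open>x \<noteq> p i\<close>. Hence the total gradient has norm at most \<open>\<epsilon>\<close>.

  As \<open>\<epsilon>\<close> tends to zero, the \<open>\<epsilon>\<close>-normals have weakly convergent subsequences
  (\<open>bounded_sequence_weakly_convergent_subsequence\<close>), whose limits are limiting normals, and
  well-posedness gives strongly convergent subsequences of projections. The limits of all summands
  add up to zero.
\<close>

section \<open>Weak sequential compactness in Hilbert spaces\<close>

text \<open>
  No compactness is needed: by the parallelogram law, points of almost minimal norm in a convex set
  are close to each other. The minimal norms \<open>\<rho> m\<close> of the nested sets increase to a finite limit \<open>d\<close>,
  so the parts of norm at most \<open>d + 1 / Suc m\<close> are nested closed sets with diameters tending to zero,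
  and completeness applies.
\<close>

lemma bounded_closed_convex_nest:
  fixes C :: "nat \<Rightarrow> 'a::{real_inner, complete_space} set"
  assumes closed: "\<And>m. closed (C m)" and convex: "\<And>m. convex (C m)"
    and nonempty: "\<And>m. C m \<noteq> {}" and mono: "\<And>m k. m \<le> k \<Longrightarrow> C k \<subseteq> C m"
    and bounded: "bounded (C 0)"
  obtains a where "\<And>m. a \<in> C m"
proof -
  define \<rho> where "\<rho> m = infdist 0 (C m)" for m
  obtain B where B: "\<And>x. x \<in> C 0 \<Longrightarrow> norm x \<le> B"
    using bounded by (auto simp: bounded_iff)
  have \<rho>_le: "\<rho> m \<le> norm x" if "x \<in> C m" for x m
    using infdist_le[OF that, of 0] by (simp add: \<rho>_def)
  have \<rho>_nonneg: "0 \<le> \<rho> m" for m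
    by (simp add: \<rho>_def infdist_nonneg)
  have "incseq \<rho>"
    unfolding \<rho>_def by (intro monoI infdist_mono mono nonempty)
  moreover have "\<rho> m \<le> B" for m
    using nonempty[of m] mono[of 0 m] B \<rho>_le by (metis all_not_in_conv le0 order_trans subsetD)
  ultimately obtain d where d: "\<rho> \<longlonglongrightarrow> d" "\<And>m. \<rho> m \<le> d"
    using incseq_convergent[of \<rho> B] by blast
  define T where "T m = C m \<inter> cball 0 (d + 1 / Suc m)" for m
  obtain a where "\<And>m. a \<in> T m"
  proof (rule decreasing_closed_nest[of T])
    show "closed (T m)" for m
      by (simp add: T_def closed closed_Int)
    show "T m \<noteq> {}" for m
    proof -
      have "\<rho> m < d + 1 / Suc m"
        by (rule le_less_trans[OF d(2)]) simp
      then obtain x where "x \<in> C m" "dist 0 x < d + 1 / Suc m"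
        unfolding \<rho>_def infdist_notempty[OF nonempty]
        by (subst (asm) cINF_less_iff) (auto simp: nonempty intro!: bdd_belowI[of _ 0])
      then show ?thesis
        by (auto simp: T_def)
    qed
    show "T k \<subseteq> T m" if "m \<le> k" for m k
    proof -
      have "1 / real (Suc k) \<le> 1 / real (Suc m)"
        using that by (intro divide_left_mono) auto
      then show ?thesis
        using mono[OF that] by (force simp: T_def)
    qed
    show "\<exists>m. \<forall>x\<in>T m. \<forall>y\<in>T m. dist x y < e" if "e > 0" for e
    proof -
      have "(\<lambda>m. 4 * (d + 1 / real (Suc m))\<^sup>2 - 4 * (\<rho> m)\<^sup>2) \<longlonglongrightarrow> 4 * (d + 0)\<^sup>2 - 4 * d\<^sup>2"
        by (intro tendsto_intros d LIMSEQ_Suc[OF lim_1_over_n])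
      then have "\<forall>\<^sub>F m in sequentially. 4 * (d + 1 / real (Suc m))\<^sup>2 - 4 * (\<rho> m)\<^sup>2 < e\<^sup>2"
        using that by (intro order_tendstoD) auto
      then obtain m where m: "4 * (d + 1 / real (Suc m))\<^sup>2 - 4 * (\<rho> m)\<^sup>2 < e\<^sup>2"
        using eventually_happens'[OF sequentially_bot] by blast
      have "dist x y < e" if xy: "x \<in> T m" "y \<in> T m" for x y
      proof -
        have "(1/2) *\<^sub>R x + (1/2) *\<^sub>R y \<in> C m"
          using convexD[OF convex[of m], of x y "1/2" "1/2"] xy by (simp add: T_def)
        from \<rho>_le[OF this] have "2 * \<rho> m \<le> norm (x + y)"
          by (simp flip: scaleR_add_right)
        then have "(2 * \<rho> m)\<^sup>2 \<le> (norm (x + y))\<^sup>2"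
          using \<rho>_nonneg[of m] by (intro power_mono) auto
        moreover have "(norm x)\<^sup>2 \<le> (d + 1 / Suc m)\<^sup>2" "(norm y)\<^sup>2 \<le> (d + 1 / Suc m)\<^sup>2"
          using xy by (auto simp: T_def intro!: power_mono)
        moreover have "(dist x y)\<^sup>2 + (norm (x + y))\<^sup>2 = 2 * (norm x)\<^sup>2 + 2 * (norm y)\<^sup>2"
          by (simp add: dist_norm power2_norm_eq_inner inner_simps inner_commute)
        ultimately have "(dist x y)\<^sup>2 < e\<^sup>2"
          using m by (simp add: power_mult_distrib)
        then show ?thesis
          using \<open>e > 0\<close> by (simp add: power2_less_imp_less)
      qed
      then show ?thesis by blast
    qed
  qed blast
  then show ?thesis
    using that by (auto simp: T_def)
qed

text \<open>
  Used with \<open>z\<close> the difference of two candidate weak limits: if \<open>z\<close> is orthogonal to all members of a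
  sequence, it is orthogonal to both candidates, hence to itself.
\<close>

lemma closed_hull_inner_const:
  assumes "\<And>x. x \<in> S \<Longrightarrow> z \<bullet> x = c" and "y \<in> closure (convex hull S)"
  shows "z \<bullet> y = c"
proof -
  have "closure (convex hull S) \<subseteq> {y. z \<bullet> y = c}"
    using assms(1) by (intro closure_minimal hull_minimal closed_hyperplane convex_hyperplane) auto
  then show ?thesis
    using assms(2) by auto
qed

text \<open>
  A point common to the closed convex hulls of all tails is the only possible weak limit:
  a functional that converges along the sequence is eventually confined to a thin slab, which is
  closed and convex and so contains the hull of a tail. Such points stand in for the Riesz
  representation theorem.
\<close>

lemma tail_hulls_common_point:
  fixes v :: "nat \<Rightarrow> 'a::{real_inner, complete_space}"
  assumes bound: "\<And>k. norm (v k) \<le> B"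
  shows "\<exists>a. norm a \<le> B \<and> a \<in> closure (convex hull (range v)) \<and>
    (\<forall>z c. ((\<lambda>k. v k \<bullet> z) \<longlonglongrightarrow> c) \<longrightarrow> a \<bullet> z = c)"
proof -
  define C where "C m = closure (convex hull (v ` {m..}))" for m
  have sub: "C m \<subseteq> K" if "closed K" "convex K" "v ` {m..} \<subseteq> K" for m K
    unfolding C_def using that by (intro closure_minimal hull_minimal) auto
  have "C 0 \<subseteq> cball 0 B"
    using bound by (intro sub) auto
  moreover obtain a where a: "\<And>m. a \<in> C m"
  proof (rule bounded_closed_convex_nest[of C])
    show "bounded (C 0)"
      using \<open>C 0 \<subseteq> cball 0 B\<close> bounded_cball bounded_subset by blast
    show "C k \<subseteq> C m" if "m \<le> k" for m k
      unfolding C_def using that by (intro closure_mono hull_mono image_mono) auto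
  qed (auto simp: C_def)
  moreover have "a \<bullet> z = c" if lim: "(\<lambda>k. v k \<bullet> z) \<longlonglongrightarrow> c" for z c
  proof -
    have "\<bar>a \<bullet> z - c\<bar> \<le> e" if "e > 0" for e
    proof -
      obtain m where m: "\<And>k. k \<ge> m \<Longrightarrow> \<bar>v k \<bullet> z - c\<bar> < e"
        using LIMSEQ_D[OF lim \<open>e > 0\<close>] by (auto simp: real_norm_def)
      have "C m \<subseteq> {x. z \<bullet> x \<le> c + e} \<inter> {x. z \<bullet> x \<ge> c - e}"
        using m by (intro sub closed_Int convex_Int closed_halfspace_le closed_halfspace_ge
            convex_halfspace_le convex_halfspace_ge) (force simp: inner_commute abs_le_iff)
      then have "a \<in> {x. z \<bullet> x \<le> c + e} \<inter> {x. z \<bullet> x \<ge> c - e}"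
        using a by blast
      then show ?thesis
        by (simp add: inner_commute abs_le_iff)
    qed
    then have "\<bar>a \<bullet> z - c\<bar> \<le> 0"
      by (rule field_le_epsilon) simp
    then show ?thesis by simp
  qed
  ultimately show ?thesis
    using a[of 0] by (intro exI[of _ a]) (auto simp: C_def atLeast_0)
qed

text \<open>
  A diagonal argument makes the inner products with the countably many members of the sequence
  converge. This determines the weak limit: if the inner products with
  some other vector \<open>z\<close> did not converge to the expected value, a further subsequence would have its
  own tail-hull point \<open>b\<close>, and \<open>a - b\<close> would be orthogonal to the sequence and therefore zero.
\<close>

lemma bounded_sequence_weakly_convergent_subsequence:
  fixes v :: "nat \<Rightarrow> 'a::{real_inner, complete_space}"
  assumes bound: "\<And>k. norm (v k) \<le> B"
  obtains r a where "strict_mono (r :: nat \<Rightarrow> nat)" "norm a \<le> B" "weakly_tendsto (v \<circ> r) a"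
proof -
  have gram_bound: "norm (v k \<bullet> z) \<le> B * B" if "z \<in> range v" for k z
  proof -
    have "norm (v k \<bullet> z) \<le> norm (v k) * norm z"
      by (simp add: Cauchy_Schwarz_ineq2)
    also have "\<dots> \<le> B * B"
      using that bound by (intro mult_mono) (auto intro: order_trans[OF norm_ge_zero])
    finally show ?thesis .
  qed
  have "\<exists>r. strict_mono (r :: nat \<Rightarrow> nat) \<and> (\<forall>z\<in>range v. \<exists>l. (\<lambda>k. v (r k) \<bullet> z) \<longlonglongrightarrow> l)"
  proof (rule function_convergent_subsequence[of "range v" "\<lambda>k z. v k \<bullet> z" "B * B"])
    fix r :: "nat \<Rightarrow> nat"
    assume "strict_mono r" "\<And>z. z \<in> range v \<Longrightarrow> \<exists>l. (\<lambda>k. v (r k) \<bullet> z) \<longlonglongrightarrow> l"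
    then show ?thesis by blast
  qed (use gram_bound in simp_all)
  then obtain r where r: "strict_mono (r :: nat \<Rightarrow> nat)"
    and gram: "\<And>z. z \<in> range v \<Longrightarrow> \<exists>l. (\<lambda>k. v (r k) \<bullet> z) \<longlonglongrightarrow> l"
    by blast
  define u where "u = v \<circ> r"
  have u: "norm (u k) \<le> B" for k
    by (simp add: u_def bound)
  obtain a where a: "norm a \<le> B" "a \<in> closure (convex hull (range u))"
      "\<And>z c. (\<lambda>k. u k \<bullet> z) \<longlonglongrightarrow> c \<Longrightarrow> a \<bullet> z = c"
    using tail_hulls_common_point[of u, OF u] by blast
  have "(\<lambda>k. u k \<bullet> z) \<longlonglongrightarrow> a \<bullet> z" for z
  proof (rule ccontr)
    assume "\<not> ?thesis"
    then obtain e where "e > 0" and not_near: "\<not> (\<forall>\<^sub>F k in sequentially. dist (u k \<bullet> z) (a \<bullet> z) < e)"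
      by (auto simp: tendsto_iff)
    obtain s where s: "strict_mono (s :: nat \<Rightarrow> nat)"
      and far: "\<And>k. dist (u (s k) \<bullet> z) (a \<bullet> z) \<ge> e"
      using not_eventually_sequentiallyD[OF not_near] by (auto simp: not_less)
    have "bounded (range (\<lambda>k. u (s k) \<bullet> z))"
    proof -
      have "norm (u (s k) \<bullet> z) \<le> B * norm z" for k
        using Cauchy_Schwarz_ineq2[of "u (s k)" z] mult_right_mono[OF u[of "s k"], of "norm z"]
        by (simp add: real_norm_def)
      then show ?thesis
        by (auto simp: bounded_iff)
    qed
    then obtain l t where t: "strict_mono (t :: nat \<Rightarrow> nat)"
      and lim: "(\<lambda>k. u (s (t k)) \<bullet> z) \<longlonglongrightarrow> l"
      using bounded_imp_convergent_subsequence unfolding o_def by blast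
    obtain b where b: "b \<in> closure (convex hull (range (u \<circ> s \<circ> t)))"
        "\<And>z c. (\<lambda>k. u (s (t k)) \<bullet> z) \<longlonglongrightarrow> c \<Longrightarrow> b \<bullet> z = c"
      using tail_hulls_common_point[of "u \<circ> s \<circ> t" B] u by (auto simp: o_def)
    have st: "strict_mono (s \<circ> t)"
      using s t by (rule strict_mono_o)
    have orth: "(a - b) \<bullet> y = 0" if "y \<in> range u" for y
    proof -
      have "y \<in> range v"
        using that by (auto simp: u_def)
      then obtain c where c: "(\<lambda>k. u k \<bullet> y) \<longlonglongrightarrow> c"
        using gram[of y] by (auto simp: u_def)
      have "b \<bullet> y = c"
        using b(2) LIMSEQ_subseq_LIMSEQ[OF c st] by (simp add: o_def)
      with a(3)[OF c] show ?thesis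
        by (simp add: inner_diff_left)
    qed
    have "b \<in> closure (convex hull (range u))"
      using b(1) closure_mono[OF hull_mono[of "range (u \<circ> s \<circ> t)" "range u" convex]] by auto
    then have "(a - b) \<bullet> (a - b) = 0"
      using closed_hull_inner_const[of "range u" "a - b" 0] orth a(2)
      by (simp add: inner_diff_right)
    then have "l = a \<bullet> z"
      using b(2)[OF lim] by simp
    moreover have "e \<le> dist l (a \<bullet> z)"
      by (rule tendsto_le[OF _ tendsto_dist[OF lim tendsto_const] tendsto_const]) (simp_all add: far)
    ultimately show False
      using \<open>e > 0\<close> by simp
  qed
  then show ?thesis
    using that[OF r a(1)] by (simp add: weakly_tendsto_def u_def)
qed

section \<open>Ekeland's variational principle\<close>

text \<open>
  Order \<open>S\<close> by letting \<open>y\<close> lie below \<open>x\<close> if moving from \<open>x\<close> to \<open>y\<close> decreases \<open>F\<close> by at least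
  \<open>\<epsilon> * dist x y\<close>. Descending repeatedly to an almost lowest available point makes the sets \<open>T (u k)\<close>
  of points still below shrink to a single one, from which no further descent is possible.
\<close>

theorem ekeland_variational_principle:
  fixes F :: "'a::complete_space \<Rightarrow> real"
  assumes "closed S" and cont: "continuous_on S F" and lower: "\<And>y. y \<in> S \<Longrightarrow> m \<le> F y"
    and "x0 \<in> S" and start: "F x0 \<le> m + \<epsilon>\<^sup>2" and "\<epsilon> > 0"
  shows "\<exists>x\<in>S. dist x0 x \<le> \<epsilon> \<and> (\<forall>y\<in>S. F x \<le> F y + \<epsilon> * dist x y)"
proof -
  define T where "T x = {y \<in> S. F y + \<epsilon> * dist x y \<le> F x}" for x
  have T_refl: "x \<in> T x" if "x \<in> S" for x
    using that by (simp add: T_def)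
  have T_trans: "T y \<subseteq> T x" if "y \<in> T x" for x y
  proof
    fix z assume "z \<in> T y"
    have "\<epsilon> * dist x z \<le> \<epsilon> * dist x y + \<epsilon> * dist y z"
      using dist_triangle[of x z y] \<open>\<epsilon> > 0\<close> by (simp flip: distrib_left)
    then show "z \<in> T x"
      using \<open>z \<in> T y\<close> that by (auto simp: T_def)
  qed
  have T_closed: "closed (T x)" for x
    unfolding T_def using \<open>closed S\<close>
    by (intro continuous_on_closed_Collect_le continuous_intros cont)
  have "\<exists>y. y \<in> T x \<and> (\<forall>z\<in>T x. F y \<le> F z + (1/2) ^ k)" if xS: "x \<in> S" for x k
  proof -
    have bdd: "bdd_below (F ` T x)"
      using lower by (intro bdd_belowI[of _ m]) (auto simp: T_def)
    have "Inf (F ` T x) < Inf (F ` T x) + (1/2) ^ k"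
      by simp
    then obtain y where "y \<in> T x" "F y < Inf (F ` T x) + (1/2) ^ k"
      using T_refl[OF xS] bdd by (subst (asm) cInf_less_iff) auto
    moreover have "Inf (F ` T x) \<le> F z" if "z \<in> T x" for z
      using bdd that by (intro cInf_lower) auto
    ultimately show ?thesis
      by (intro exI[of _ y]) (auto intro: less_imp_le[OF less_le_trans])
  qed
  note step = someI_ex[OF this]
  define nxt where "nxt k x = (SOME y. y \<in> T x \<and> (\<forall>z\<in>T x. F y \<le> F z + (1/2) ^ k))" for k x
  have nxt: "\<And>x k. x \<in> S \<Longrightarrow> nxt k x \<in> T x"
      "\<And>x k z. x \<in> S \<Longrightarrow> z \<in> T x \<Longrightarrow> F (nxt k x) \<le> F z + (1/2) ^ k"
    using step by (simp_all add: nxt_def)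
  define u where "u = rec_nat x0 nxt"
  have u_0: "u 0 = x0" and u_Suc: "u (Suc k) = nxt k (u k)" for k
    by (simp_all add: u_def)
  have u_S: "u k \<in> S" for k
    by (induction k) (use \<open>x0 \<in> S\<close> nxt(1) in \<open>auto simp: u_0 u_Suc T_def\<close>)
  have u_T: "u (Suc k) \<in> T (u k)" for k
    using nxt(1)[OF u_S] by (simp add: u_Suc)
  have T_u_dec: "T (u l) \<subseteq> T (u k)" if "k \<le> l" for k l
    using lift_Suc_antimono_le[of "\<lambda>k. T (u k)", OF T_trans[OF u_T] that] .
  have small: "\<epsilon> * dist (u (Suc k)) y \<le> (1/2) ^ k" if "y \<in> T (u (Suc k))" for k y
  proof -
    have "F (u (Suc k)) \<le> F y + (1/2) ^ k"
      unfolding u_Suc using that T_trans[OF u_T] by (intro nxt(2)[OF u_S]) auto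
    with that show ?thesis
      by (simp add: T_def)
  qed
  obtain x where x: "\<And>k. x \<in> T (u k)"
  proof (rule decreasing_closed_nest[of "\<lambda>k. T (u k)"])
    show "\<exists>k. \<forall>x\<in>T (u k). \<forall>y\<in>T (u k). dist x y < e" if "e > 0" for e
    proof -
      have "0 < \<epsilon> * e / 2"
        using \<open>\<epsilon> > 0\<close> that by simp
      then obtain k where k: "(1/2) ^ k < \<epsilon> * e / 2"
        using real_arch_pow_inv[of "\<epsilon> * e / 2" "1/2"] by auto
      have "dist x y < e" if "x \<in> T (u (Suc k))" "y \<in> T (u (Suc k))" for x y
      proof -
        have "\<epsilon> * dist x y \<le> \<epsilon> * (dist (u (Suc k)) x + dist (u (Suc k)) y)"
          using \<open>\<epsilon> > 0\<close> by (simp add: dist_triangle3)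
        also have "\<dots> < \<epsilon> * e"
          using small[OF that(1)] small[OF that(2)] k by (simp add: distrib_left)
        finally show ?thesis
          using \<open>\<epsilon> > 0\<close> by simp
      qed
      then show ?thesis by blast
    qed
    show "T (u k) \<noteq> {}" for k
      using T_refl[OF u_S] by blast
  qed (use T_closed T_u_dec in blast)+
  have "x \<in> S"
    using x[of 0] by (simp add: T_def)
  show ?thesis
  proof (intro bexI[of _ x] conjI ballI)
    show "x \<in> S" by fact
    have "\<epsilon> * dist x0 x \<le> \<epsilon> * \<epsilon>"
      using x[of 0] start lower[OF \<open>x \<in> S\<close>] by (simp add: T_def u_0 power2_eq_square)
    then show "dist x0 x \<le> \<epsilon>"
      using \<open>\<epsilon> > 0\<close> by simp
    fix y assume "y \<in> S"
    show "F x \<le> F y + \<epsilon> * dist x y"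
    proof (cases "y \<in> T x")
      case True
      have "\<epsilon> * dist x y \<le> 0 + e" if "e > 0" for e
      proof -
        have "0 < e / 2"
          using that by simp
        then obtain k where k: "(1/2) ^ k < e / 2"
          using real_arch_pow_inv[of "e / 2" "1/2"] by auto
        have "y \<in> T (u (Suc k))"
          using True T_trans[OF x] by blast
        have "\<epsilon> * dist x y \<le> \<epsilon> * (dist (u (Suc k)) x + dist (u (Suc k)) y)"
          using \<open>\<epsilon> > 0\<close> by (simp add: dist_triangle3)
        also have "\<dots> \<le> e"
          using small[OF x[of "Suc k"]] small[OF \<open>y \<in> T (u (Suc k))\<close>] k by (simp add: distrib_left)
        finally show ?thesis by simp
      qed
      then have "\<epsilon> * dist x y \<le> 0"
        by (rule field_le_epsilon)
      then have "dist x y \<le> 0"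
        using \<open>\<epsilon> > 0\<close> by (simp add: mult_le_0_iff)
      then show ?thesis by simp
    next
      case False
      then show ?thesis
        using \<open>y \<in> S\<close> by (simp add: T_def)
    qed
  qed
qed

section \<open>Gradients and approximate normals\<close>

text \<open>
  Applied with \<open>S = \<Omega> i\<close> it produces the approximate normals, and with \<open>S = UNIV\<close>, together with the
  next lemma, the bound on the total gradient.
\<close>

lemma approx_minimizer_neg_gradient_normal:
  fixes h :: "'a::real_inner \<Rightarrow> real"
  assumes "x \<in> S" and deriv: "(h has_derivative (\<lambda>v. g \<bullet> v)) (at x)"
    and min: "\<forall>\<^sub>F y in at x within S. h x \<le> h y + \<epsilon> * norm (y - x)"
  shows "- g \<in> eps_normals \<epsilon> x S"
proof -
  have lim: "((\<lambda>y. (h y - h x - g \<bullet> (y - x)) / norm (y - x)) \<longlongrightarrow> 0) (at x within S)"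
    using has_derivative_at_withinI[OF deriv, of S] by (simp add: has_derivative_within diff_diff_eq)
  have "\<forall>\<^sub>F y in at x within S. ereal ((- g \<bullet> (y - x)) / norm (y - x)) < c" if c: "c > ereal \<epsilon>" for c
  proof -
    obtain b where b: "ereal \<epsilon> < ereal b" "ereal b < c"
      using ereal_dense2[OF c] by auto
    have "\<forall>\<^sub>F y in at x within S. (h y - h x - g \<bullet> (y - x)) / norm (y - x) < b - \<epsilon>"
      using order_tendstoD(2)[OF lim] b(1) by simp
    then show ?thesis
      using min eventually_neq_at_within[of x x S]
    proof eventually_elim
      case (elim y)
      then have "norm (y - x) > 0" by auto
      then have "h y - h x - g \<bullet> (y - x) < (b - \<epsilon>) * norm (y - x)"
        using elim(1) by (simp add: pos_divide_less_eq)
      then have "- g \<bullet> (y - x) < b * norm (y - x)"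
        using elim(2) by (simp add: algebra_simps)
      then have "(- g \<bullet> (y - x)) / norm (y - x) < b"
        using \<open>norm (y - x) > 0\<close> by (subst pos_divide_less_eq)
      then show ?case
        using b(2) less_trans by (metis less_ereal.simps(1))
    qed
  qed
  then show ?thesis
    using \<open>x \<in> S\<close> by (simp add: eps_normals_def Limsup_le_iff)
qed

text \<open>
  Approaching \<open>x\<close> from the direction of \<open>v\<close> itself makes the quotient in the upper limit equal to
  \<open>norm v\<close>.
\<close>

lemma eps_normals_UNIV_norm_le:
  fixes v :: "'a::real_inner"
  assumes v: "v \<in> eps_normals \<epsilon> x UNIV" and "\<epsilon> \<ge> 0"
  shows "norm v \<le> \<epsilon>"
proof (rule ccontr)
  assume "\<not> norm v \<le> \<epsilon>"
  then have "v \<noteq> 0" and "ereal \<epsilon> < ereal (norm v)"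
    using \<open>\<epsilon> \<ge> 0\<close> by auto
  then have "\<forall>\<^sub>F u in at x. ereal ((v \<bullet> (u - x)) / norm (u - x)) < ereal (norm v)"
    using v by (simp add: eps_normals_def Limsup_le_iff del: ereal_less_ereal_Ex less_ereal.simps)
  moreover have "filterlim (\<lambda>t. x + t *\<^sub>R v) (at x) (at_right 0)"
  proof (rule filterlim_atI)
    have "((\<lambda>t. x + t *\<^sub>R v) \<longlongrightarrow> x + 0 *\<^sub>R v) (at_right 0)"
      by (intro tendsto_intros)
    then show "((\<lambda>t. x + t *\<^sub>R v) \<longlongrightarrow> x) (at_right 0)" by simp
    show "\<forall>\<^sub>F t in at_right 0. x + t *\<^sub>R v \<noteq> x"
      using \<open>v \<noteq> 0\<close> by (auto simp: eventually_at_filter)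
  qed
  ultimately have "\<forall>\<^sub>F t in at_right 0. (v \<bullet> (t *\<^sub>R v)) / norm (t *\<^sub>R v) < norm v"
    by (auto dest: eventually_compose_filterlim)
  then have "\<forall>\<^sub>F t in at_right (0::real). False"
    using eventually_at_right_less[of 0]
  proof eventually_elim
    case (elim t)
    then have "(v \<bullet> (t *\<^sub>R v)) / norm (t *\<^sub>R v) = norm v"
      using \<open>v \<noteq> 0\<close> by (simp add: dot_square_norm power2_eq_square)
    with elim show ?case by simp
  qed
  then show False by simp
qed

text \<open>
  The parameter \<open>0\<close> is allowed and gives the norm itself, so that active summands (\<open>\<delta> > 0\<close>, smooth
  everywhere) and inactive ones (\<open>\<delta> = 0\<close>, smooth away from the origin) can be treated alike.
\<close>

definition soft_norm :: "real \<Rightarrow> 'a::real_inner \<Rightarrow> real" where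
  "soft_norm \<delta> z = sqrt ((norm z)\<^sup>2 + \<delta>\<^sup>2)"

text \<open>
The gradient of \<open>soft_norm \<delta>\<close> at \<open>z\<close> wherever it exists, cf. \<open>has_derivative_soft_norm\<close>.
\<close>

definition soft_dir :: "real \<Rightarrow> 'a::real_inner \<Rightarrow> 'a" where
  "soft_dir \<delta> z = z /\<^sub>R soft_norm \<delta> z"

lemma norm_le_soft_norm: "norm z \<le> soft_norm \<delta> z"
  by (simp add: soft_norm_def real_le_rsqrt)

lemma soft_norm_0_right: "soft_norm \<delta> 0 = \<bar>\<delta>\<bar>"
  by (simp add: soft_norm_def)

lemma soft_norm_0_left: "soft_norm 0 z = norm z"
  by (simp add: soft_norm_def)

lemma norm_soft_dir_le_1: "norm (soft_dir \<delta> z) \<le> 1"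
proof (cases "soft_norm \<delta> z = 0")
  case False
  then have "soft_norm \<delta> z > 0"
    by (simp add: soft_norm_def less_le)
  then show ?thesis
    using norm_le_soft_norm[of z \<delta>] by (simp add: soft_dir_def divide_simps)
qed (simp add: soft_dir_def)

lemma has_derivative_soft_norm:
  assumes "\<delta> \<noteq> 0 \<or> z \<noteq> 0"
  shows "(soft_norm \<delta> has_derivative (\<lambda>v. soft_dir \<delta> z \<bullet> v)) (at z)"
proof -
  have "0 < z \<bullet> z + \<delta>\<^sup>2"
    using assms by (auto intro: add_pos_nonneg add_nonneg_pos)
  then have "((\<lambda>y. sqrt (y \<bullet> y + \<delta>\<^sup>2)) has_derivative (\<lambda>v. soft_dir \<delta> z \<bullet> v)) (at z)"
    by (auto intro!: derivative_eq_intros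
        simp: soft_dir_def soft_norm_def power2_norm_eq_inner inner_commute field_simps)
  then show ?thesis
    by (simp add: soft_norm_def[abs_def] power2_norm_eq_inner)
qed

section \<open>Approximate stationarity\<close>

text \<open>
  The distance of two functions is a series over an enumeration of their arguments with weights
  \<open>(1/2)^n\<close>. The enumeration may repeat \<open>i\<close>, so the bound uses the sum \<open>2\<close> of all
  weights. By this estimate Ekeland's principle on a function space, with the variables as
  coordinates, can be used one variable at a time.
\<close>

lemma dist_fun_upd_le:
  fixes f :: "'i::countable \<Rightarrow> 'a::metric_space"
  shows "dist f (f(i := y)) \<le> 2 * dist (f i) y"
proof -
  let ?a = "\<lambda>n. (1/2)^n * min (dist (f (from_nat n)) ((f(i := y)) (from_nat n))) 1"
  have "(\<lambda>n. (1/2)^n * dist (f i) y) sums (2 * dist (f i) y)"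
    using sums_mult2[OF geometric_sums[of "1/2::real"], of "dist (f i) y"] by simp
  moreover have le: "?a n \<le> (1/2)^n * dist (f i) y" for n
    by (intro mult_left_mono) auto
  moreover have "summable ?a"
    by (rule summable_comparison_test[OF _ sums_summable[OF calculation(1)]])
      (use le in \<open>auto intro!: exI[of _ 0]\<close>)
  ultimately show ?thesis
    unfolding dist_fun_def by (metis (no_types, lifting) suminf_le sums_summable sums_unique)
qed

text \<open>
  The bound on the sum is stated for every choice \<open>p\<close> of projections, since the choice that has a
  convergent subsequence becomes available only after \<open>x\<close> is known for all \<open>\<epsilon>\<close>.
\<close>

lemma fuzzy_fermat:
  fixes \<Omega> :: "nat \<Rightarrow> 'a::{real_inner, complete_space} set"
  assumes closed: "\<And>i. i \<in> {1..n} \<Longrightarrow> closed (\<Omega> i)"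
    and min: "local_minimizer (\<lambda>x. \<Sum>i = 1..n. infdist x (\<Omega> i)) xbar"
    and "\<epsilon> > 0"
  shows "\<exists>x \<delta> w. dist x xbar < \<epsilon> \<and>
    (\<forall>i\<in>{1..n}. xbar \<in> \<Omega> i \<longrightarrow>
        dist (w i) xbar < \<epsilon> \<and> soft_dir \<delta> (x - w i) \<in> eps_normals \<epsilon> (w i) (\<Omega> i)) \<and>
    (\<forall>p. (\<forall>i\<in>{1..n}. xbar \<notin> \<Omega> i \<longrightarrow> p i \<in> metric_proj x (\<Omega> i)) \<longrightarrow>
        norm (\<Sum>i = 1..n. if xbar \<in> \<Omega> i then soft_dir \<delta> (x - w i)
                         else (x - p i) /\<^sub>R infdist x (\<Omega> i)) \<le> \<epsilon>)"
proof -
  define D where "D x = (\<Sum>i = 1..n. infdist x (\<Omega> i))" for x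
  have "\<forall>\<^sub>F y in nhds xbar. \<forall>i\<in>{i \<in> {1..n}. xbar \<notin> \<Omega> i}. y \<notin> \<Omega> i"
    using closed
    by (intro eventually_ball_finite ballI)
       (auto simp: eventually_nhds intro!: exI[of _ "- \<Omega> i" for i])
  moreover have "\<forall>\<^sub>F y in nhds xbar. D xbar \<le> D y"
    using min by (simp add: local_minimizer_def D_def)
  ultimately have "\<forall>\<^sub>F y in nhds xbar. D xbar \<le> D y \<and> (\<forall>i\<in>{1..n}. xbar \<notin> \<Omega> i \<longrightarrow> y \<notin> \<Omega> i)"
    by eventually_elim auto
  then obtain \<rho>0 where "\<rho>0 > 0"
    and \<rho>0: "\<And>y. dist y xbar < \<rho>0 \<Longrightarrow> D xbar \<le> D y \<and> (\<forall>i\<in>{1..n}. xbar \<notin> \<Omega> i \<longrightarrow> y \<notin> \<Omega> i)"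
    by (auto simp: eventually_nhds_metric)
  define \<rho> where "\<rho> = \<rho>0 / 2"
  have "\<rho> > 0" and D_min: "\<And>y. dist y xbar \<le> \<rho> \<Longrightarrow> D xbar \<le> D y"
    and outside: "\<And>y i. dist y xbar \<le> \<rho> \<Longrightarrow> i \<in> {1..n} \<Longrightarrow> xbar \<notin> \<Omega> i \<Longrightarrow> y \<notin> \<Omega> i"
    using \<open>\<rho>0 > 0\<close> \<rho>0 by (auto simp: \<rho>_def)

  \<comment> \<open>The variables are coordinates of \<open>f :: nat \<Rightarrow> 'a\<close>: \<open>f 0\<close> is \<open>x\<close>, and \<open>f i\<close> is \<open>w i\<close> for active \<open>i\<close>.\<close>
  define c :: "nat \<Rightarrow> 'a" where "c = (\<lambda>_. xbar)"
  have coord: "continuous_on A (\<lambda>f :: nat \<Rightarrow> 'a. f i)" for A i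
    by (rule continuous_on_subset[OF continuous_on_product_coordinates]) simp
  have "\<forall>\<^sub>F f in nhds c. \<forall>i\<in>{0..n}. dist (f i) xbar < min \<epsilon> \<rho>"
  proof (intro eventually_ball_finite ballI)
    fix i
    have "isCont (\<lambda>f. f i) c"
      using continuous_on_interior[OF coord[of UNIV i]] by simp
    then have "((\<lambda>f. f i) \<longlongrightarrow> c i) (nhds c)"
      by (rule iffD1[OF tendsto_at_iff_tendsto_nhds, OF iffD1[OF isCont_def]])
    then show "\<forall>\<^sub>F f in nhds c. dist (f i) xbar < min \<epsilon> \<rho>"
      using \<open>\<rho> > 0\<close> \<open>\<epsilon> > 0\<close> by (auto simp: c_def dest: tendstoD[of _ _ _ "min \<epsilon> \<rho>"])
  qed simp
  then obtain \<eta> where "\<eta> > 0"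
    and \<eta>: "\<And>f i. dist f c < \<eta> \<Longrightarrow> i \<le> n \<Longrightarrow> dist (f i) xbar < min \<epsilon> \<rho>"
    by (auto simp: eventually_nhds_metric)
  \<comment> \<open>Half of \<open>\<epsilon>\<close> absorbs the factor 2 of \<open>dist_fun_upd_le\<close>; \<open>\<delta>\<close> keeps the total smoothing error below \<open>\<epsilon>'\<^sup>2\<close>.\<close>
  define \<epsilon>' where "\<epsilon>' = min (\<eta> / 2) (\<epsilon> / 2)"
  have "\<epsilon>' > 0" "\<epsilon>' < \<eta>" "2 * \<epsilon>' \<le> \<epsilon>"
    using \<open>\<eta> > 0\<close> \<open>\<epsilon> > 0\<close> by (auto simp: \<epsilon>'_def)
  define \<delta> where "\<delta> = \<epsilon>'\<^sup>2 / (n + 1)"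
  have "\<delta> > 0" "n * \<delta> \<le> \<epsilon>'\<^sup>2"
    using \<open>\<epsilon>' > 0\<close> by (auto simp: \<delta>_def field_simps)

  define S where "S = {f :: nat \<Rightarrow> 'a. dist (f 0) xbar \<le> \<rho> \<and> (\<forall>i\<in>{1..n}. xbar \<in> \<Omega> i \<longrightarrow> f i \<in> \<Omega> i)}"
  define summand where
    "summand i f = (if xbar \<in> \<Omega> i then soft_norm \<delta> (f 0 - f i) else infdist (f 0) (\<Omega> i))" for i and f :: "nat \<Rightarrow> 'a"
  define F where "F f = (\<Sum>i = 1..n. summand i f)" for f
  have "closed S"
  proof -
    have "S = (\<lambda>f. f 0) -` cball xbar \<rho> \<inter> (\<Inter>i\<in>{i \<in> {1..n}. xbar \<in> \<Omega> i}. (\<lambda>f. f i) -` \<Omega> i)"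
      by (auto simp: S_def dist_commute)
    then show ?thesis
      using closed coord[of UNIV] by (auto intro!: closed_Int closed_INT closed_vimage)
  qed
  moreover have "continuous_on S F"
  proof -
    have "continuous_on S (summand i)" for i
      by (cases "xbar \<in> \<Omega> i")
        (auto simp: summand_def[abs_def] soft_norm_def intro!: continuous_intros coord)
    then show ?thesis
      unfolding F_def[abs_def] by (auto intro: continuous_on_sum)
  qed
  moreover have "D xbar \<le> F f" if "f \<in> S" for f
  proof -
    have "D (f 0) \<le> F f"
      unfolding D_def F_def
    proof (rule sum_mono)
      fix i assume "i \<in> {1..n}"
      then show "infdist (f 0) (\<Omega> i) \<le> summand i f"
        using that infdist_le[of "f i" "\<Omega> i" "f 0"] norm_le_soft_norm[of "f 0 - f i" \<delta>]
        by (auto simp: summand_def S_def dist_norm)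
    qed
    then show ?thesis
      using D_min[of "f 0"] that by (auto simp: S_def)
  qed
  moreover have "c \<in> S"
    using \<open>\<rho> > 0\<close> by (auto simp: S_def c_def)
  moreover have "F c \<le> D xbar + \<epsilon>'\<^sup>2"
  proof -
    have "F c \<le> (\<Sum>i = 1..n. infdist xbar (\<Omega> i) + \<delta>)"
      unfolding F_def using \<open>\<delta> > 0\<close>
      by (intro sum_mono) (simp add: summand_def c_def soft_norm_0_right infdist_nonneg)
    then show ?thesis
      using \<open>n * \<delta> \<le> \<epsilon>'\<^sup>2\<close> by (simp add: sum.distrib D_def)
  qed
  ultimately have "\<exists>f\<in>S. dist c f \<le> \<epsilon>' \<and> (\<forall>g\<in>S. F f \<le> F g + \<epsilon>' * dist f g)"
    using \<open>\<epsilon>' > 0\<close> by (rule ekeland_variational_principle[of S F "D xbar" c \<epsilon>'])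
  then obtain f where "f \<in> S" "dist c f \<le> \<epsilon>'"
    and f_min: "\<And>g. g \<in> S \<Longrightarrow> F f \<le> F g + \<epsilon>' * dist f g"
    by blast
  define x where "x = f 0"
  have near: "dist (f i) xbar < min \<epsilon> \<rho>" if "i \<le> n" for i
    using \<eta> \<open>dist c f \<le> \<epsilon>'\<close> \<open>\<epsilon>' < \<eta>\<close> that by (simp add: dist_commute)
  have f_upd_min: "F f \<le> F (f(i := y)) + \<epsilon> * norm (y - f i)" if "f(i := y) \<in> S" for i y
  proof -
    have "\<epsilon>' * dist f (f(i := y)) \<le> \<epsilon>' * (2 * dist (f i) y)"
      using \<open>\<epsilon>' > 0\<close> by (intro mult_left_mono dist_fun_upd_le) auto
    also have "\<dots> \<le> \<epsilon> * dist (f i) y"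
      using mult_right_mono[OF \<open>2 * \<epsilon>' \<le> \<epsilon>\<close>, of "dist (f i) y"] by (simp add: mult_ac)
    finally show ?thesis
      using f_min[OF that] by (simp add: dist_norm norm_minus_commute)
  qed

  \<comment> \<open>Vary the coordinate \<open>f i\<close> alone, inside \<open>\<Omega> i\<close>.\<close>
  have normal: "soft_dir \<delta> (x - f i) \<in> eps_normals \<epsilon> (f i) (\<Omega> i)"
    if i: "i \<in> {1..n}" "xbar \<in> \<Omega> i" for i
  proof -
    have "- (- soft_dir \<delta> (x - f i)) \<in> eps_normals \<epsilon> (f i) (\<Omega> i)"
    proof (rule approx_minimizer_neg_gradient_normal)
      show "f i \<in> \<Omega> i"
        using \<open>f \<in> S\<close> i by (auto simp: S_def)
      have "(soft_norm \<delta> has_derivative (\<lambda>v. soft_dir \<delta> (x - f i) \<bullet> v)) (at (x - f i))"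
        using \<open>\<delta> > 0\<close> by (intro has_derivative_soft_norm) simp
      moreover have "((\<lambda>y. x - y) has_derivative (\<lambda>v. - v)) (at (f i))"
        by (auto intro!: derivative_eq_intros)
      ultimately have "((\<lambda>y. soft_norm \<delta> (x - y)) has_derivative (\<lambda>v. soft_dir \<delta> (x - f i) \<bullet> - v)) (at (f i))"
        by (rule has_derivative_compose[rotated])
      then show "((\<lambda>y. soft_norm \<delta> (x - y)) has_derivative (\<lambda>v. - soft_dir \<delta> (x - f i) \<bullet> v)) (at (f i))"
        by simp
      have "soft_norm \<delta> (x - f i) \<le> soft_norm \<delta> (x - y) + \<epsilon> * norm (y - f i)" if "y \<in> \<Omega> i" for y
      proof -
        have "f(i := y) \<in> S"
          using \<open>f \<in> S\<close> that i by (auto simp: S_def)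
        moreover have "F g = summand i g + (\<Sum>j\<in>{1..n} - {i}. summand j g)" for g
          unfolding F_def using i by (intro sum.remove) auto
        moreover have "(\<Sum>j\<in>{1..n} - {i}. summand j (f(i := y))) = (\<Sum>j\<in>{1..n} - {i}. summand j f)"
          using i by (intro sum.cong) (auto simp: summand_def)
        ultimately show ?thesis
          using f_upd_min[of i y] i by (simp add: summand_def x_def)
      qed
      then show "\<forall>\<^sub>F y in at (f i) within \<Omega> i.
          soft_norm \<delta> (x - f i) \<le> soft_norm \<delta> (x - y) + \<epsilon> * norm (y - f i)"
        by (auto simp: eventually_at_filter)
    qed
    then show ?thesis by simp
  qed

  \<comment> \<open>Vary \<open>x\<close> alone, with the smooth majorant \<open>h\<close> of the objective, which is exact at \<open>x\<close>.\<close>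
  have balance: "norm (\<Sum>i = 1..n. if xbar \<in> \<Omega> i then soft_dir \<delta> (x - f i)
                         else (x - p i) /\<^sub>R infdist x (\<Omega> i)) \<le> \<epsilon>"
    if p: "\<forall>i\<in>{1..n}. xbar \<notin> \<Omega> i \<longrightarrow> p i \<in> metric_proj x (\<Omega> i)" for p
  proof -
    have "dist x xbar < \<rho>"
      using near[of 0] by (simp add: x_def)
    define q where "q i = (if xbar \<in> \<Omega> i then f i else p i)" for i
    define \<gamma> where "\<gamma> i = (if xbar \<in> \<Omega> i then \<delta> else 0)" for i
    define h where "h y = (\<Sum>i = 1..n. soft_norm (\<gamma> i) (y - q i))" for y
    define g where "g = (\<Sum>i = 1..n. soft_dir (\<gamma> i) (x - q i))"
    have p_dist: "p i \<in> \<Omega> i" "infdist x (\<Omega> i) = norm (x - p i)" "x \<noteq> p i"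
      if "i \<in> {1..n}" "xbar \<notin> \<Omega> i" for i
      using p that outside[of x i] \<open>dist x xbar < \<rho>\<close> by (auto simp: metric_proj_def)
    have "((\<lambda>y. soft_norm (\<gamma> i) (y - q i)) has_derivative (\<lambda>v. soft_dir (\<gamma> i) (x - q i) \<bullet> v)) (at x)"
      if "i \<in> {1..n}" for i
    proof -
      have "(soft_norm (\<gamma> i) has_derivative (\<lambda>v. soft_dir (\<gamma> i) (x - q i) \<bullet> v)) (at (x - q i))"
        using that \<open>\<delta> > 0\<close> p_dist(3) by (intro has_derivative_soft_norm) (auto simp: \<gamma>_def q_def)
      moreover have "((\<lambda>y. y - q i) has_derivative (\<lambda>v. v)) (at x)"
        by (auto intro!: derivative_eq_intros)
      ultimately show ?thesis
        by (rule has_derivative_compose[rotated])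
    qed
    then have "(h has_derivative (\<lambda>v. g \<bullet> v)) (at x)"
      unfolding h_def[abs_def] g_def inner_sum_left by (rule has_derivative_sum)
    moreover have "\<forall>\<^sub>F y in at x. h x \<le> h y + \<epsilon> * norm (y - x)"
    proof -
      have "\<forall>\<^sub>F y in nhds x. y \<in> ball xbar \<rho>"
        using \<open>dist x xbar < \<rho>\<close> by (intro eventually_nhds_in_open) (auto simp: dist_commute)
      then have "\<forall>\<^sub>F y in at x. y \<in> ball xbar \<rho>"
        by (simp add: eventually_at_filter eventually_mono)
      then show ?thesis
      proof eventually_elim
        case (elim y)
        have "h x = F f"
          unfolding h_def F_def using p_dist
          by (intro sum.cong) (auto simp: summand_def x_def q_def \<gamma>_def soft_norm_0_left)
        also have "\<dots> \<le> F (f(0 := y)) + \<epsilon> * norm (y - x)"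
          unfolding x_def using elim \<open>f \<in> S\<close> by (intro f_upd_min) (auto simp: S_def dist_commute)
        also have "F (f(0 := y)) \<le> h y"
          unfolding h_def F_def
        proof (rule sum_mono)
          fix i assume "i \<in> {1..n}"
          then show "summand i (f(0 := y)) \<le> soft_norm (\<gamma> i) (y - q i)"
            using p_dist(1)[of i] infdist_le[of "p i" "\<Omega> i" y]
            by (auto simp: summand_def q_def \<gamma>_def soft_norm_0_left dist_norm)
        qed
        finally show ?case by simp
      qed
    qed
    ultimately have "- g \<in> eps_normals \<epsilon> x UNIV"
      by (intro approx_minimizer_neg_gradient_normal) auto
    then have "norm g \<le> \<epsilon>"
      using eps_normals_UNIV_norm_le[of "- g" \<epsilon> x] \<open>\<epsilon> > 0\<close> by simp
    moreover have "g = (\<Sum>i = 1..n. if xbar \<in> \<Omega> i then soft_dir \<delta> (x - f i)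
                         else (x - p i) /\<^sub>R infdist x (\<Omega> i))"
      unfolding g_def using p_dist(2)
      by (intro sum.cong) (auto simp: q_def \<gamma>_def soft_dir_def soft_norm_0_left)
    ultimately show ?thesis by simp
  qed
  show ?thesis
    using near normal balance
    by (intro exI[of _ x] exI[of _ \<delta>] exI[of _ f]) (auto simp: x_def)
qed

section \<open>Passage to the limit\<close>

lemma weakly_tendsto_subseq:
  "weakly_tendsto g a \<Longrightarrow> strict_mono s \<Longrightarrow> weakly_tendsto (g \<circ> s) a"
  unfolding weakly_tendsto_def using LIMSEQ_subseq_LIMSEQ by (fastforce simp: o_def)

lemma tendsto_imp_weakly_tendsto:
  "g \<longlonglongrightarrow> a \<Longrightarrow> weakly_tendsto g a"
  unfolding weakly_tendsto_def by (auto intro!: tendsto_intros)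

text \<open>
  The terms \<open>g\<close> are chosen only after the subsequence \<open>r\<close>, because well-posedness provides projections
  for a given sequence and says nothing about projections that were fixed before.
\<close>

lemma finite_common_weak_subsequence:
  fixes G :: "'i \<Rightarrow> nat \<Rightarrow> 'a::real_inner set"
  assumes "finite I"
    and "\<And>i r. i \<in> I \<Longrightarrow> strict_mono (r :: nat \<Rightarrow> nat) \<Longrightarrow>
      \<exists>s g a. strict_mono (s :: nat \<Rightarrow> nat) \<and> (\<forall>k. g k \<in> G i (r (s k))) \<and> a \<in> A i \<and> weakly_tendsto g a"
  shows "\<exists>r g a. strict_mono (r :: nat \<Rightarrow> nat) \<and>
      (\<forall>i\<in>I. (\<forall>k. g i k \<in> G i (r k)) \<and> a i \<in> A i \<and> weakly_tendsto (g i) (a i))"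
  using assms
proof (induction I rule: finite_induct)
  case empty
  then show ?case
    using strict_mono_id by blast
next
  case (insert j I)
  then obtain r g a where r: "strict_mono r"
    and g: "\<And>i. i \<in> I \<Longrightarrow> (\<forall>k. g i k \<in> G i (r k)) \<and> a i \<in> A i \<and> weakly_tendsto (g i) (a i)"
    by blast
  obtain s g' a' where s: "strict_mono s"
    and g': "\<forall>k. g' k \<in> G j (r (s k))" "a' \<in> A j" "weakly_tendsto g' a'"
    using insert.prems[of j, OF _ r] by blast
  show ?case
  proof (intro exI conjI ballI)
    show "strict_mono (r \<circ> s)"
      using r s by (rule strict_mono_o)
    fix i assume "i \<in> insert j I"
    then have *: "i = j \<or> i \<noteq> j \<and> i \<in> I" by blast
    show "\<forall>k. ((\<lambda>i. g i \<circ> s)(j := g')) i k \<in> G i ((r \<circ> s) k)" "(a(j := a')) i \<in> A i"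
      using * g g' by auto
    show "weakly_tendsto (((\<lambda>i. g i \<circ> s)(j := g')) i) ((a(j := a')) i)"
      using *
    proof
      assume "i \<noteq> j \<and> i \<in> I"
      then show ?thesis
        using weakly_tendsto_subseq[OF _ s, of "g i" "a i"] g by simp
    qed (simp add: g'(3))
  qed
qed

(* The sum of sets in the conclusion is the Minkowski sum of HOL-Library.Set_Algebras. *)
theorem theorem4p3:
  fixes \<Omega> :: "nat \<Rightarrow> ('a::{real_inner, complete_space}) set"
    and n :: nat and xbar :: 'a
  assumes "\<And>i. i \<in> {1..n} \<Longrightarrow> \<Omega> i \<noteq> {}"
    and "\<And>i. i \<in> {1..n} \<Longrightarrow> closed (\<Omega> i)"
    and "local_minimizer (\<lambda>x. \<Sum>i = 1..n. infdist x (\<Omega> i)) xbar"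
    and "\<And>i. i \<in> {1..n} \<Longrightarrow> xbar \<notin> \<Omega> i \<Longrightarrow> dist_well_posed_at xbar (\<Omega> i)"
  shows "0 \<in> (\<Sum>i = 1..n. fermat_set xbar (\<Omega> i))"
proof -
  define \<epsilon> where "\<epsilon> k = 1 / real (Suc k)" for k
  have "\<epsilon> \<longlonglongrightarrow> 0"
    unfolding \<epsilon>_def by (rule LIMSEQ_Suc[OF lim_1_over_n])
  then have \<epsilon>: "\<epsilon> k > 0" "decseq \<epsilon>" "\<epsilon> \<longlonglongrightarrow> 0" for k
    by (auto intro!: decseq_SucI simp: \<epsilon>_def field_simps)
  define P where "P k x \<delta> w \<longleftrightarrow> dist x xbar < \<epsilon> k \<and>
    (\<forall>i\<in>{1..n}. xbar \<in> \<Omega> i \<longrightarrow>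
        dist (w i) xbar < \<epsilon> k \<and> soft_dir \<delta> (x - w i) \<in> eps_normals (\<epsilon> k) (w i) (\<Omega> i)) \<and>
    (\<forall>p. (\<forall>i\<in>{1..n}. xbar \<notin> \<Omega> i \<longrightarrow> p i \<in> metric_proj x (\<Omega> i)) \<longrightarrow>
        norm (\<Sum>i = 1..n. if xbar \<in> \<Omega> i then soft_dir \<delta> (x - w i)
                         else (x - p i) /\<^sub>R infdist x (\<Omega> i)) \<le> \<epsilon> k)" for k x \<delta> w
  have "\<forall>k. \<exists>x \<delta> w. P k x \<delta> w"
    unfolding P_def using fuzzy_fermat[OF assms(2,3) \<epsilon>(1)] by blast
  then obtain X \<Delta> W where P: "\<And>k. P k (X k) (\<Delta> k) (W k)"
    by metis
  have X: "X \<longlonglongrightarrow> xbar"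
    by (rule metric_tendsto_imp_tendsto[OF \<epsilon>(3)]) (use P \<epsilon>(1) in \<open>auto simp: P_def less_imp_le abs_of_pos\<close>)
  define G where "G i k = (if xbar \<in> \<Omega> i then {soft_dir (\<Delta> k) (X k - W k i)}
      else (\<lambda>p. (X k - p) /\<^sub>R infdist (X k) (\<Omega> i)) ` metric_proj (X k) (\<Omega> i))" for i k
  have "\<exists>s g a. strict_mono (s :: nat \<Rightarrow> nat) \<and> (\<forall>k. g k \<in> G i (r (s k))) \<and>
      a \<in> fermat_set xbar (\<Omega> i) \<and> weakly_tendsto g a"
    if i: "i \<in> {1..n}" and r: "strict_mono r" for i r
  proof (cases "xbar \<in> \<Omega> i")
    case True
    define v where "v k = soft_dir (\<Delta> (r k)) (X (r k) - W (r k) i)" for k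
    obtain s a where s: "strict_mono s" and a: "norm a \<le> 1" "weakly_tendsto (v \<circ> s) a"
      using bounded_sequence_weakly_convergent_subsequence[of v 1] norm_soft_dir_le_1
      unfolding v_def by blast
    have rs: "strict_mono (r \<circ> s)"
      using r s by (rule strict_mono_o)
    have "(\<lambda>k. W k i) \<longlonglongrightarrow> xbar"
      by (rule metric_tendsto_imp_tendsto[OF \<epsilon>(3)])
        (use P \<epsilon>(1) i True in \<open>auto simp: P_def less_imp_le abs_of_pos\<close>)
    then have W: "(\<lambda>k. W (r (s k)) i) \<longlonglongrightarrow> xbar"
      using LIMSEQ_subseq_LIMSEQ[OF _ rs] by (force simp: o_def)
    have "a \<in> limiting_normal_cone xbar (\<Omega> i)"
      unfolding limiting_normal_cone_def
    proof (intro CollectI exI conjI allI)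
      show "0 \<le> (\<epsilon> \<circ> r \<circ> s) k" for k
        using \<epsilon>(1) by (simp add: less_imp_le)
      show "decseq (\<epsilon> \<circ> r \<circ> s)"
        using \<epsilon>(2) strict_mono_mono[OF rs] by (auto simp: monotone_on_def)
      show "(\<epsilon> \<circ> r \<circ> s) \<longlonglongrightarrow> 0"
        using LIMSEQ_subseq_LIMSEQ[OF \<epsilon>(3) rs] by (simp add: o_assoc)
      show "(\<lambda>k. W (r (s k)) i) \<longlonglongrightarrow> xbar" by (fact W)
      show "(v \<circ> s) k \<in> eps_normals ((\<epsilon> \<circ> r \<circ> s) k) (W (r (s k)) i) (\<Omega> i)" for k
        using P[of "r (s k)"] i True by (auto simp: P_def v_def)
    qed (fact a(2))
    then have "a \<in> fermat_set xbar (\<Omega> i)"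
      using a(1) True by (simp add: fermat_set_def)
    moreover have "\<forall>k. (v \<circ> s) k \<in> G i (r (s k))"
      using True by (simp add: G_def v_def)
    ultimately show ?thesis
      using s a(2) by blast
  next
    case False
    have "(X \<circ> r) \<longlonglongrightarrow> xbar"
      by (rule LIMSEQ_subseq_LIMSEQ[OF X r])
    then obtain w s l where w: "\<And>k. w k \<in> metric_proj ((X \<circ> r) k) (\<Omega> i)"
      and s: "strict_mono s" and l: "(w \<circ> s) \<longlonglongrightarrow> l"
      using assms(4)[OF i False] unfolding dist_well_posed_at_def convergent_def by blast
    define u where "u k = X (r (s k))" for k
    have u: "u \<longlonglongrightarrow> xbar"
      using LIMSEQ_subseq_LIMSEQ[OF \<open>(X \<circ> r) \<longlonglongrightarrow> xbar\<close> s] by (simp add: u_def[abs_def] o_def)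
    have ws: "(w \<circ> s) k \<in> \<Omega> i" "norm (u k - (w \<circ> s) k) = infdist (u k) (\<Omega> i)" for k
      using w[of "s k"] by (auto simp: metric_proj_def u_def)
    have "l \<in> \<Omega> i"
      using closed_sequentially[OF assms(2)[OF i] _ l] ws(1) by blast
    have lim: "(\<lambda>k. infdist (u k) (\<Omega> i)) \<longlonglongrightarrow> infdist xbar (\<Omega> i)"
      by (intro tendsto_infdist u)
    moreover have "(\<lambda>k. norm (u k - (w \<circ> s) k)) \<longlonglongrightarrow> norm (xbar - l)"
      by (intro tendsto_intros u l)
    ultimately have "norm (xbar - l) = infdist xbar (\<Omega> i)"
      unfolding ws(2) by (metis LIMSEQ_unique)
    with \<open>l \<in> \<Omega> i\<close> have "l \<in> metric_proj xbar (\<Omega> i)"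
      by (simp add: metric_proj_def)
    then have "(xbar - l) /\<^sub>R infdist xbar (\<Omega> i) \<in> fermat_set xbar (\<Omega> i)"
      using False by (auto simp: fermat_set_def)
    moreover have "infdist xbar (\<Omega> i) \<noteq> 0"
      using \<open>norm (xbar - l) = infdist xbar (\<Omega> i)\<close> \<open>l \<in> \<Omega> i\<close> False by auto
    then have "weakly_tendsto (\<lambda>k. (u k - (w \<circ> s) k) /\<^sub>R infdist (u k) (\<Omega> i))
        ((xbar - l) /\<^sub>R infdist xbar (\<Omega> i))"
      by (intro tendsto_imp_weakly_tendsto tendsto_intros u l lim)
    moreover have "\<forall>k. (u k - (w \<circ> s) k) /\<^sub>R infdist (u k) (\<Omega> i) \<in> G i (r (s k))"
      using w False by (auto simp: G_def u_def)
    ultimately show ?thesis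
      using s by (intro exI conjI)
  qed
  then have "\<exists>r g a. strict_mono (r :: nat \<Rightarrow> nat) \<and> (\<forall>i\<in>{1..n}.
      (\<forall>k. g i k \<in> G i (r k)) \<and> a i \<in> fermat_set xbar (\<Omega> i) \<and> weakly_tendsto (g i) (a i))"
    by (intro finite_common_weak_subsequence finite_atLeastAtMost)
  then obtain r g a where r: "strict_mono (r :: nat \<Rightarrow> nat)"
    and g: "\<And>i k. i \<in> {1..n} \<Longrightarrow> g i k \<in> G i (r k)"
    and a: "\<And>i. i \<in> {1..n} \<Longrightarrow> a i \<in> fermat_set xbar (\<Omega> i)"
    and lim: "\<And>i. i \<in> {1..n} \<Longrightarrow> weakly_tendsto (g i) (a i)"
    by blast
  have small: "norm (\<Sum>i = 1..n. g i k) \<le> \<epsilon> k" for k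
  proof -
    have "\<forall>i. \<exists>p. i \<in> {1..n} \<longrightarrow> xbar \<notin> \<Omega> i \<longrightarrow> p \<in> metric_proj (X (r k)) (\<Omega> i) \<and>
        g i k = (X (r k) - p) /\<^sub>R infdist (X (r k)) (\<Omega> i)"
      using g[of _ k] by (fastforce simp: G_def)
    then obtain p where p: "\<And>i. i \<in> {1..n} \<Longrightarrow> xbar \<notin> \<Omega> i \<Longrightarrow>
        p i \<in> metric_proj (X (r k)) (\<Omega> i) \<and> g i k = (X (r k) - p i) /\<^sub>R infdist (X (r k)) (\<Omega> i)"
      by metis
    have "(\<Sum>i = 1..n. g i k) = (\<Sum>i = 1..n. if xbar \<in> \<Omega> i then soft_dir (\<Delta> (r k)) (X (r k) - W (r k) i)
        else (X (r k) - p i) /\<^sub>R infdist (X (r k)) (\<Omega> i))"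
    proof (intro sum.cong refl)
      fix i assume i: "i \<in> {1..n}"
      show "g i k = (if xbar \<in> \<Omega> i then soft_dir (\<Delta> (r k)) (X (r k) - W (r k) i)
          else (X (r k) - p i) /\<^sub>R infdist (X (r k)) (\<Omega> i))"
        using g[OF i, of k] p[OF i] by (simp add: G_def split: if_splits)
    qed
    also have "norm \<dots> \<le> \<epsilon> (r k)"
      using P[of "r k"] p unfolding P_def by blast
    also have "\<dots> \<le> \<epsilon> k"
      using \<epsilon>(2) seq_suble[OF r] by (simp add: decseq_def)
    finally show ?thesis .
  qed
  have "(\<Sum>i = 1..n. a i) \<bullet> y = 0" for y
  proof (rule LIMSEQ_unique)
    show "(\<lambda>k. (\<Sum>i = 1..n. g i k) \<bullet> y) \<longlonglongrightarrow> (\<Sum>i = 1..n. a i) \<bullet> y"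
      unfolding inner_sum_left using lim by (intro tendsto_sum) (simp add: weakly_tendsto_def)
    have "(\<lambda>k. \<Sum>i = 1..n. g i k) \<longlonglongrightarrow> 0"
      using small by (intro Lim_null_comparison[OF _ \<epsilon>(3)]) auto
    then show "(\<lambda>k. (\<Sum>i = 1..n. g i k) \<bullet> y) \<longlonglongrightarrow> 0"
      using tendsto_inner[OF _ tendsto_const, of _ 0 _ y] by force
  qed
  then have "(\<Sum>i = 1..n. a i) = 0"
    by (metis inner_eq_zero_iff)
  then show ?thesis
    using a by (auto simp: set_sum_alt intro!: exI[of _ a])
qed

end
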